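(* Define $a_1(0)=a_1(1)=1$ and $a_1(m)=a_1(m-1)+a_1(m-2)$ for $m\ge 2$, and let $c(n)=a_1(n)^2$. Then for all integers $n\ge 0$, $$c(n) = |\mathsf{Av}^2_n(\overline{121}, 123, 132, 213)|.$$
   Context: For an integer $n\ge 0$ let $[n]=\{1,2,\ldots,n\}$. A $2$-regular word over $[n]$ is a word of length $2n$ in which each symbol of $[n]$ appears exactly twice (for $n=0$ the only such word is the empty word). A word $w=w_1\cdots w_N$ contains a (classical) pattern $p=p_1\cdots p_r$ if there are indices $i_1<\cdots<i_r$ such that $w_{i_1}\cdots w_{i_r}$ is order isomorphic to $p$ (same strict inequalities and same equalities between corresponding positions). A word contains the consecutive (fully vincular) pattern $\overline{121}$ if it has three consecutive symbols of the form $xyx$ with $y>x$. A word avoids a pattern if it does not contain it. $\mathsf{Av}^2_n(\overline{121},123,132,213)$ is the set of $2$-regular words over $[n]$ that avoid the consecutive pattern $\overline{121}$ and the classical patterns $123$, $132$, $213$. *)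

theory Defs
  imports Main "HOL-Library.Sublist"
begin

definition regular2_word :: "nat \<Rightarrow> nat list \<Rightarrow> bool" where
  "regular2_word n w \<longleftrightarrow>
     length w = 2 * n \<and> set w \<subseteq> {1..n} \<and> (\<forall>k\<in>{1..n}. count_list w k = 2)"

definition order_isomorphic :: "nat list \<Rightarrow> nat list \<Rightarrow> bool" where
  "order_isomorphic u p \<longleftrightarrow>
     length u = length p \<and>
     (\<forall>i<length p. \<forall>j<length p.
        (u ! i < u ! j \<longleftrightarrow> p ! i < p ! j) \<and> (u ! i = u ! j \<longleftrightarrow> p ! i = p ! j))"

text \<open>A classical pattern may occur in arbitrary positions (\<open>subseq\<close>), whereas the letters of
  a consecutive occurrence must be adjacent (\<open>sublist\<close>, a contiguous factor).\<close>

definition contains_pattern :: "nat list \<Rightarrow> nat list \<Rightarrow> bool" where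
  "contains_pattern w p \<longleftrightarrow> (\<exists>u. subseq u w \<and> order_isomorphic u p)"

definition contains_consecutive_121 :: "nat list \<Rightarrow> bool" where
  "contains_consecutive_121 w \<longleftrightarrow> (\<exists>x y. x < y \<and> sublist [x, y, x] w)"

definition Av2 :: "nat \<Rightarrow> nat list set" where
  "Av2 n = {w. regular2_word n w \<and> \<not> contains_consecutive_121 w \<and>
               \<not> contains_pattern w [1, 2, 3] \<and>
               \<not> contains_pattern w [1, 3, 2] \<and>
               \<not> contains_pattern w [2, 1, 3]}"

fun a1 :: "nat \<Rightarrow> nat" where
  "a1 0 = 1"
| "a1 (Suc 0) = 1"
| "a1 (Suc (Suc m)) = a1 (Suc m) + a1 m"

definition c :: "nat \<Rightarrow> nat" where
  "c n = (a1 n)\<^sup>2"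

end

theory Submission
  imports Defs "HOL-Library.Multiset"
begin

text \<open>
  Avoiding \<open>123\<close>, \<open>132\<close> and \<open>213\<close> together means that no letter is followed by two different larger
  letters and no letter is preceded by two different smaller ones. Let \<open>N\<close> be the largest letter of
  such a word and \<open>K = N - 1\<close>, and let \<open>K\<close> occur too. Every other letter in front of the last \<open>N\<close> must
  be \<open>K\<close>: a smaller one would form a forbidden triple with this \<open>N\<close> and any \<open>K\<close>
  (\<open>letters_before_last_largest\<close>). So the word is a short word in \<open>K\<close> and \<open>N\<close> that ends with \<open>N\<close>, followed by a word \<open>v\<close> in letters up to \<open>K\<close>. Conversely such a
  prefix never takes part in one of the three patterns (\<open>avoids_append_two_largest\<close>), so \<open>v\<close> may be
  any avoiding word with the remaining letters that completes no consecutive \<open>121\<close> with the prefix.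

  If every letter occurs twice, this leaves the prefixes \<open>NN\<close>, \<open>KKNN\<close>, \<open>NKKN\<close>, \<open>KNN\<close>, \<open>NKN\<close>, since \<open>KNK\<close>
  is forbidden. After \<open>KNN\<close> or \<open>NKN\<close> one \<open>K\<close> remains for \<open>v\<close>; after \<open>NKN\<close> the word \<open>v\<close> must not start
  with it, and after \<open>KNN\<close> it may, in which case this \<open>K\<close> can be counted into the prefix. So let \<open>A k\<close>
  be the number of avoiding words in which exactly the letters \<open>1, ..., k\<close> occur, each twice, and \<open>T k\<close>
  the number of those in which a single \<open>k + 1\<close> is added that is not the first letter. Then
  \<open>A (k+2) = A (k+1) + 3 A k + 2 T k\<close> and, by the same decomposition, \<open>T (k+1) = A k + T k\<close>
  (\<open>avoiding_recursion\<close>, \<open>single_top_recursion\<close>). Writing \<open>F\<close> for the Fibonacci sequence \<open>a1\<close>, induction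
  gives \<open>A k = (F k)\<^sup>2\<close> together with \<open>T k = F k * F (k+1) - (F k)\<^sup>2\<close>; the step for \<open>A\<close> is
  \<open>(F (k+1))\<^sup>2 + (F k)\<^sup>2 + 2 F k * F (k+1) = (F (k+2))\<^sup>2\<close>.
\<close>

section \<open>The classical patterns\<close>

text \<open>The three patterns are covered in two overlapping pairs: \<open>123\<close> and \<open>132\<close> put two different
  larger letters behind a letter, \<open>123\<close> and \<open>213\<close> put two different smaller letters in front of one. This form needs no case distinction on the order of the
  two letters.\<close>

definition avoids_123_132_213 :: "nat list \<Rightarrow> bool" where
  "avoids_123_132_213 w \<longleftrightarrow> (\<forall>x y z. subseq [x, y, z] w \<longrightarrow>
     \<not> (x < y \<and> x < z \<and> y \<noteq> z) \<and> \<not> (x < z \<and> y < z \<and> x \<noteq> y))"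

lemma contains_pattern_length3:
  "contains_pattern w [p, q, r] \<longleftrightarrow>
     (\<exists>x y z. subseq [x, y, z] w \<and> order_isomorphic [x, y, z] [p, q, r])"
proof
  assume "contains_pattern w [p, q, r]"
  then obtain u where u: "subseq u w" "order_isomorphic u [p, q, r]"
    unfolding contains_pattern_def by blast
  then have "length u = Suc (Suc (Suc 0))" by (simp add: order_isomorphic_def)
  then obtain x y z where "u = [x, y, z]" by (auto simp: length_Suc_conv)
  with u show "\<exists>x y z. subseq [x, y, z] w \<and> order_isomorphic [x, y, z] [p, q, r]" by blast
qed (auto simp: contains_pattern_def)

lemma avoids_123_132_213_iff:
  "avoids_123_132_213 w \<longleftrightarrow> \<not> contains_pattern w [1, 2, 3] \<and> \<not> contains_pattern w [1, 3, 2] \<and>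
               \<not> contains_pattern w [2, 1, 3]"
proof -
  have 1: "order_isomorphic [x, y, z] [1, 2, 3] \<longleftrightarrow> x < y \<and> y < z" for x y z
    by (auto simp: order_isomorphic_def All_less_Suc)
  have 2: "order_isomorphic [x, y, z] [1, 3, 2] \<longleftrightarrow> x < z \<and> z < y" for x y z
    by (auto simp: order_isomorphic_def All_less_Suc)
  have 3: "order_isomorphic [x, y, z] [2, 1, 3] \<longleftrightarrow> y < x \<and> x < z" for x y z
    by (auto simp: order_isomorphic_def All_less_Suc)
  have "\<not> (x < y \<and> x < z \<and> y \<noteq> z) \<and> \<not> (x < z \<and> y < z \<and> x \<noteq> y) \<longleftrightarrow>
      \<not> (x < y \<and> y < z) \<and> \<not> (x < z \<and> z < y) \<and> \<not> (y < x \<and> x < z)" for x y z :: nat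
    by linarith
  then show ?thesis
    unfolding avoids_123_132_213_def contains_pattern_length3 1 2 3 by blast
qed

lemma subseq_imp_subset: "subseq u w \<Longrightarrow> set u \<subseteq> set w"
  by (auto elim: list_emb_set)

text \<open>A letter \<open>k\<close> of the prefix has only \<open>Suc k\<close> above it, so it cannot be followed by two different
  larger letters; and two different letters below a letter of \<open>v\<close> are both less than \<open>k\<close>, hence both
  in \<open>v\<close>.\<close>

lemma avoids_append_two_largest:
  assumes p: "set p \<subseteq> {k, Suc k}" and v: "set v \<subseteq> {..k}"
  shows "avoids_123_132_213 (p @ v) \<longleftrightarrow> avoids_123_132_213 v"
proof
  assume "avoids_123_132_213 (p @ v)"
  then show "avoids_123_132_213 v"
    unfolding avoids_123_132_213_def by (blast intro: list_emb_append2)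
next
  assume sv: "avoids_123_132_213 v"
  show "avoids_123_132_213 (p @ v)"
    unfolding avoids_123_132_213_def
  proof (intro allI impI)
    fix x y z assume "subseq [x, y, z] (p @ v)"
    then obtain a b where ab: "[x, y, z] = a @ b" "subseq a p" "subseq b v"
      unfolding subseq_append_iff by blast
    have sub: "set a \<subseteq> {k, Suc k}" "set b \<subseteq> {..k}"
      using ab(2,3) p v by (auto dest: subseq_imp_subset)
    show "\<not> (x < y \<and> x < z \<and> y \<noteq> z) \<and> \<not> (x < z \<and> y < z \<and> x \<noteq> y)"
    proof (cases a)
      case Nil
      then have "subseq [x, y, z] v" using ab by simp
      then show ?thesis using sv unfolding avoids_123_132_213_def by blast
    next
      case (Cons x' a')
      then have "x \<in> {k, Suc k}" using ab sub by auto
      have "z \<le> k \<or> b = []"  using ab sub by (cases b rule: rev_cases) auto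
      moreover have "{y, z} \<subseteq> {k, Suc k}" if "b = []" using ab sub that by auto
      moreover have "{x, y, z} \<subseteq> {..Suc k}"
        using arg_cong[OF ab(1), of set] sub by auto
      ultimately show ?thesis using \<open>x \<in> {k, Suc k}\<close> by auto
    qed
  qed
qed

lemma subseq_of_factors:
  assumes "x \<in> set p" "y \<in> set q" "z \<in> set r"
  shows "subseq [x, y, z] (p @ q @ r)"
  using list_emb_append_mono[of "(=)" "[x]" p "[y] @ [z]" "q @ r"]
    list_emb_append_mono[of "(=)" "[y]" q "[z]" r] assms
  by (simp add: subseq_singleton_left)

text \<open>A letter \<open>x < k\<close> in front of \<open>Suc k\<close> is incompatible with any occurrence of \<open>k\<close>: a \<open>k\<close> in front
  of \<open>Suc k\<close> forms with \<open>x\<close> two smaller letters before \<open>Suc k\<close>, and a \<open>k\<close> behind it forms with \<open>Suc k\<close> two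
  larger letters after \<open>x\<close>.\<close>

lemma letters_before_last_largest:
  assumes sm: "avoids_123_132_213 w" and le: "set w \<subseteq> {..Suc k}"
    and "Suc k \<in> set w" and k: "k \<in> set w"
  obtains p v where "w = p @ Suc k # v" "set p \<subseteq> {k, Suc k}" "Suc k \<notin> set v"
proof -
  obtain p v where w: "w = p @ Suc k # v" and nv: "Suc k \<notin> set v"
    using assms(3) by (meson split_list_last)
  have "x = k" if x: "x \<in> set p" "x \<noteq> Suc k" for x
  proof (rule ccontr)
    assume xk: "x \<noteq> k"
    have "x \<in> {..Suc k}" using x(1) le w by auto
    then have lt: "x < k" using x(2) xk by simp
    obtain q r where p: "p = q @ x # r" using x(1) by (meson split_list)
    consider "k \<in> set q" | "k \<in> set r" | "k \<in> set v" using k w p lt by auto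
    then show False
    proof cases
      case 1
      then have "subseq [k, x, Suc k] w"
        unfolding w p using subseq_of_factors[of k q x "x # r" "Suc k" "Suc k # v"] by simp
      then show False using sm lt unfolding avoids_123_132_213_def by fastforce
    next
      case 2
      then have "subseq [x, k, Suc k] w"
        unfolding w p using subseq_of_factors[of x "q @ [x]" k r "Suc k" "Suc k # v"] by simp
      then show False using sm lt unfolding avoids_123_132_213_def by fastforce
    next
      case 3
      then have "subseq [x, Suc k, k] w"
        unfolding w p using subseq_of_factors[of x "q @ x # r" "Suc k" "[Suc k]" k v] by simp
      then show False using sm lt unfolding avoids_123_132_213_def by fastforce
    qed
  qed
  then show thesis using that w nv by blast
qed

section \<open>Consecutive occurrences of 121 at the front of a word\<close>

lemma consecutive_121_Cons:
  "contains_consecutive_121 (x # w) \<longleftrightarrow>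
     (\<exists>y v. w = y # x # v \<and> x < y) \<or> contains_consecutive_121 w"
  by (auto simp: contains_consecutive_121_def sublist_Cons_right prefix_def)

lemma consecutive_121_Nil: "\<not> contains_consecutive_121 []"
  by (simp add: contains_consecutive_121_def)

lemma consecutive_121_ge_Cons:
  assumes "set v \<subseteq> {..x}"
  shows "contains_consecutive_121 (x # v) \<longleftrightarrow> contains_consecutive_121 v"
  using assms by (auto simp: consecutive_121_Cons)

lemma consecutive_121_ascent_Cons:
  assumes "set v \<subseteq> {..y}" "x < y"
  shows "contains_consecutive_121 (x # y # v) \<longleftrightarrow>
     (\<exists>u. v = x # u) \<or> contains_consecutive_121 v"
  using assms
  by (cases v) (auto simp: consecutive_121_Cons[of x] consecutive_121_ge_Cons)

lemma consecutive_121_equal_Cons: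
  "contains_consecutive_121 (x # x # w) \<longleftrightarrow> contains_consecutive_121 (x # w)"
  by (auto simp: consecutive_121_Cons)

text \<open>These rules strip off, from the front, the letters of a prefix over \<open>{k, Suc k}\<close> in front of a
  word over letters up to \<open>k\<close>.\<close>

lemmas consecutive_121_prefix =
  consecutive_121_ge_Cons consecutive_121_equal_Cons consecutive_121_ascent_Cons

section \<open>Avoiding words with prescribed letters\<close>

fun doubled :: "nat \<Rightarrow> nat multiset" where
  "doubled 0 = {#}"
| "doubled (Suc k) = add_mset (Suc k) (add_mset (Suc k) (doubled k))"

lemma count_doubled: "count (doubled k) i = (if i \<in> {1..k} then 2 else 0)"
  by (induction k) auto

lemma set_mset_doubled: "set_mset (doubled k) = {1..k}"
  by (induction k) auto

lemma regular2_word_iff_mset: "regular2_word n w \<longleftrightarrow> mset w = doubled n"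
proof
  assume r: "regular2_word n w"
  have "count (mset w) i = count (doubled n) i" for i
    using r count_list_0_iff[of w i]
    by (auto simp: regular2_word_def count_doubled count_mset count_list_0_iff)
  then show "mset w = doubled n" by (rule multiset_eqI)
next
  assume m: "mset w = doubled n"
  have "size (doubled k) = 2 * k" for k by (induction k) auto
  moreover have "set w = {1..n}" by (metis m set_mset_doubled set_mset_mset)
  moreover have "count_list w i = count (doubled n) i" for i
    by (metis m count_mset)
  ultimately show "regular2_word n w"
    using m unfolding regular2_word_def by (auto simp: count_doubled simp flip: size_mset)
qed

definition avoiding :: "nat multiset \<Rightarrow> nat list set" where
  "avoiding M = {w. mset w = M \<and> avoids_123_132_213 w \<and> \<not> contains_consecutive_121 w}"

text \<open>The words left over behind a prefix \<open>NKN\<close> or \<open>KN\<close>: a leading \<open>Suc k\<close> would complete a consecutive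
  \<open>121\<close> with the end of that prefix.\<close>

definition single_top :: "nat \<Rightarrow> nat list set" where
  "single_top k = {w \<in> avoiding (add_mset (Suc k) (doubled k)). hd w \<noteq> Suc k}"

lemma Av2_eq_avoiding: "Av2 n = avoiding (doubled n)"
  by (auto simp: Av2_def avoiding_def avoids_123_132_213_iff regular2_word_iff_mset)

text \<open>The proposition \<open>P\<close> stands for a consecutive \<open>121\<close> that involves the prefix; it may be
  determined from the letters of \<open>v\<close>.\<close>

lemma avoiding_append_iff:
  assumes "set p \<subseteq> {k, Suc k}" "set_mset M \<subseteq> {..k}" and M': "M' = mset p + M"
    and 121: "set v = set_mset M \<Longrightarrow>
      contains_consecutive_121 (p @ v) \<longleftrightarrow> P \<or> contains_consecutive_121 v"
  shows "p @ v \<in> avoiding M' \<longleftrightarrow> v \<in> avoiding M \<and> \<not> P"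
proof (cases "mset v = M")
  case True
  then have v: "set v = set_mset M" by auto
  have "avoids_123_132_213 (p @ v) \<longleftrightarrow> avoids_123_132_213 v"
    using avoids_append_two_largest[OF assms(1), of v] assms(2) v by auto
  then show ?thesis using True 121[OF v] M' by (auto simp: avoiding_def)
qed (auto simp: avoiding_def M')

lemma length_two_letters:
  assumes "set p \<subseteq> {a, b}" "a \<noteq> b"
  shows "length p = count (mset p) a + count (mset p) b"
  using assms by (induction p) auto

text \<open>The bounds leave only finitely many candidates for the prefix \<open>p\<close>.\<close>

lemma avoiding_decompose:
  assumes w: "w \<in> avoiding M" and M: "set_mset M \<subseteq> {..Suc k}" "Suc k \<in># M" "k \<in># M"
  obtains p v where "w = p @ Suc k # v" "set p \<subseteq> {k, Suc k}" "Suc k \<notin> set v"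
    "Suc (count (mset p) (Suc k)) = count M (Suc k)"
    "length p \<le> count M k + count M (Suc k) - 1"
proof -
  have mw: "mset w = M" "avoids_123_132_213 w" using w by (auto simp: avoiding_def)
  have sw: "set w = set_mset M" using mw by auto
  obtain p v where pv: "w = p @ Suc k # v" "set p \<subseteq> {k, Suc k}" "Suc k \<notin> set v"
    using letters_before_last_largest[OF mw(2), of k] M sw by auto
  have 1: "Suc (count (mset p) (Suc k)) = count M (Suc k)"
    unfolding mw(1)[symmetric] pv(1) using pv(3) by (simp add: count_eq_zero_iff)
  have "count (mset p) k \<le> count M k"
    unfolding mw(1)[symmetric] pv(1) by simp
  then have "length p \<le> count M k + count M (Suc k) - 1"
    using 1 length_two_letters[OF pv(2)] by simp
  then show thesis by (rule that[OF pv 1])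
qed

lemma single_top_iff:
  "v \<in> single_top k \<longleftrightarrow>
     v \<in> avoiding (add_mset (Suc k) (doubled k)) \<and> \<not> (\<exists>u. v = Suc k # u)"
  by (cases v) (auto simp: single_top_def avoiding_def)

lemma avoiding_Cons_largest:
  assumes "set_mset M \<subseteq> {..N}"
  shows "N # v \<in> avoiding (add_mset N M) \<longleftrightarrow> v \<in> avoiding M"
  using avoiding_append_iff[of "[N]" N M "add_mset N M" v False] assms consecutive_121_ge_Cons[of v N]
  by simp

section \<open>Decomposition by the prefix up to the last largest letter\<close>

context
  fixes k K N :: nat
  assumes K: "K = Suc k" and N: "N = Suc K"
begin

text \<open>A consecutive \<open>121\<close> across the border needs a prefix that ends with \<open>KN\<close> and a \<open>K\<close> right behind it.
  So it can only arise after \<open>KN\<close> and \<open>NKN\<close>: after \<open>KKN\<close> and \<open>NKKN\<close> no \<open>K\<close> is left, and the other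
  prefixes end with \<open>NN\<close>.\<close>

lemma avoiding_KKN_iff:
  "[K, K, N] @ v \<in> avoiding (add_mset N (doubled K)) \<longleftrightarrow> v \<in> avoiding (doubled k)"
  by (subst avoiding_append_iff[of "[K, K, N]" K "doubled k" _ v "False"])
    (auto simp: K N consecutive_121_prefix set_mset_doubled dest: equalityD1)

lemma avoiding_KN_iff:
  "[K, N] @ v \<in> avoiding (add_mset N (doubled K)) \<longleftrightarrow> v \<in> single_top k"
  by (subst avoiding_append_iff[of "[K, N]" K "add_mset K (doubled k)" _ v "\<exists>u. v = K # u"])
    (auto simp: K N consecutive_121_prefix set_mset_doubled single_top_iff)

lemma avoiding_KNN_iff:
  "[K, N, N] @ v \<in> avoiding (doubled N) \<longleftrightarrow> v \<in> avoiding (add_mset K (doubled k))"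
  by (subst avoiding_append_iff[of "[K, N, N]" K "add_mset K (doubled k)" _ v "False"])
    (auto simp: K N consecutive_121_prefix set_mset_doubled consecutive_121_Cons[of K])

lemma avoiding_NKN_iff:
  "[N, K, N] @ v \<in> avoiding (doubled N) \<longleftrightarrow> v \<in> single_top k"
  by (subst avoiding_append_iff[of "[N, K, N]" K "add_mset K (doubled k)" _ v "\<exists>u. v = K # u"])
    (auto simp: K N consecutive_121_prefix set_mset_doubled single_top_iff)

lemma avoiding_KKNN_iff:
  "[K, K, N, N] @ v \<in> avoiding (doubled N) \<longleftrightarrow> v \<in> avoiding (doubled k)"
  by (subst avoiding_append_iff[of "[K, K, N, N]" K "doubled k" _ v "False"])
    (auto simp: K N consecutive_121_prefix set_mset_doubled)

lemma avoiding_NKKN_iff: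
  "[N, K, K, N] @ v \<in> avoiding (doubled N) \<longleftrightarrow> v \<in> avoiding (doubled k)"
  by (subst avoiding_append_iff[of "[N, K, K, N]" K "doubled k" _ v "False"])
    (auto simp: K N consecutive_121_prefix set_mset_doubled dest: equalityD1)

lemma avoiding_NN_iff:
  "[N, N] @ v \<in> avoiding (doubled N) \<longleftrightarrow> v \<in> avoiding (doubled K)"
  using avoiding_Cons_largest[of "doubled K" N] avoiding_Cons_largest[of "add_mset N (doubled K)" N]
  by (auto simp: N set_mset_doubled)

text \<open>Since \<open>N\<close> does not come first, something precedes it, which can only be \<open>K\<close> or \<open>KK\<close>.\<close>

lemma single_top_recursion:
  "single_top K = (@) [K, K, N] ` avoiding (doubled k) \<union> (@) [K, N] ` single_top k" (is "_ = ?R")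
proof
  show "single_top K \<subseteq> ?R"
  proof
    fix w assume "w \<in> single_top K"
    then have w: "w \<in> avoiding (add_mset N (doubled K))" and hd: "hd w \<noteq> N"
      by (auto simp: single_top_def N)
    have M: "set_mset (add_mset N (doubled K)) \<subseteq> {..Suc K}" "Suc K \<in># add_mset N (doubled K)"
      "K \<in># add_mset N (doubled K)"
      by (auto simp: set_mset_doubled K N)
    obtain p v where pv: "w = p @ N # v" "set p \<subseteq> {K, N}"
      and count: "Suc (count (mset p) N) = count (add_mset N (doubled K)) N"
        "length p \<le> count (add_mset N (doubled K)) K + count (add_mset N (doubled K)) N - 1"
      by (rule avoiding_decompose[OF w M, folded N]) (rule that)
    have p: "count (mset p) N = 0" "length p \<le> 2"
      using count by (simp_all add: K N count_doubled)
    have "p = [K] \<or> p = [K, K]"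
      using pv p hd N by (cases p; cases "tl p"; cases "tl (tl p)") auto
    then show "w \<in> ?R"
      using w pv(1) avoiding_KKN_iff[of v] avoiding_KN_iff[of v] by auto
  qed
next
  show "?R \<subseteq> single_top K"
    using avoiding_KKN_iff avoiding_KN_iff by (auto simp: single_top_def N)
qed

text \<open>Behind \<open>KNN\<close> the other \<open>K\<close> may stand anywhere. The words that have it immediately behind \<open>KNN\<close> are
  listed with the prefix \<open>KNNK\<close>, so that the rest is counted by \<open>single_top\<close> as it is after \<open>NKN\<close>.\<close>

lemma avoiding_recursion:
  "avoiding (doubled N) =
     (@) [N, N] ` avoiding (doubled K) \<union>
     (@) [K, K, N, N] ` avoiding (doubled k) \<union>
     (@) [N, K, K, N] ` avoiding (doubled k) \<union>
     (@) [K, N, N, K] ` avoiding (doubled k) \<union>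
     (@) [K, N, N] ` single_top k \<union>
     (@) [N, K, N] ` single_top k" (is "_ = ?R")
proof
  show "avoiding (doubled N) \<subseteq> ?R"
  proof
    fix w assume w: "w \<in> avoiding (doubled N)"
    have M: "set_mset (doubled N) \<subseteq> {..Suc K}" "Suc K \<in># doubled N" "K \<in># doubled N"
      by (auto simp: set_mset_doubled K N)
    obtain p v where pv: "w = p @ N # v" "set p \<subseteq> {K, N}"
      and count: "Suc (count (mset p) N) = count (doubled N) N"
        "length p \<le> count (doubled N) K + count (doubled N) N - 1"
      by (rule avoiding_decompose[OF w M, folded N]) (rule that)
    have p: "count (mset p) N = 1" "length p \<le> 3"
      using count by (simp_all add: K N count_doubled)
    have "p \<in> {[N], [K, N], [N, K], [K, K, N], [K, N, K], [N, K, K]}"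
      using pv(2) p N
      by (cases p; cases "tl p"; cases "tl (tl p)"; cases "tl (tl (tl p))") auto
    \<comment> \<open>Otherwise \<open>w\<close> would start with \<open>KNK\<close>, a consecutive \<open>121\<close>.\<close>
    moreover have "p \<noteq> [K, N, K]"
      using w pv(1) by (auto simp: avoiding_def consecutive_121_Cons N)
    moreover have "w \<in> ?R" if p: "p = [K, N]"
    proof (cases "\<exists>u. v = K # u")
      case True
      then show ?thesis using w p pv(1) avoiding_KNN_iff[of v] avoiding_Cons_largest[of "doubled k" K]
        by (auto simp: set_mset_doubled K)
    next
      case False
      then have "v \<in> single_top k"
        using w p pv(1) avoiding_KNN_iff[of v] by (simp add: single_top_iff K)
      then show ?thesis using p pv(1) by auto
    qed
    ultimately consider "w \<in> ?R" | "w = [N, N] @ v" | "w = [N, K, N] @ v"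
      | "w = [K, K, N, N] @ v" | "w = [N, K, K, N] @ v"
      using pv(1) by auto
    then show "w \<in> ?R"
    proof cases
      case 1
      then show ?thesis by blast
    next
      case 2
      then show ?thesis using w avoiding_NN_iff[of v] by blast
    next
      case 3
      then show ?thesis using w avoiding_NKN_iff[of v] by blast
    next
      case 4
      then show ?thesis using w avoiding_KKNN_iff[of v] by blast
    next
      case 5
      then show ?thesis using w avoiding_NKKN_iff[of v] by blast
    qed
  qed
next
  have "[K, N, N, K] @ v \<in> avoiding (doubled N)" if "v \<in> avoiding (doubled k)" for v
    using that avoiding_KNN_iff[of "K # v"] avoiding_Cons_largest[of "doubled k" K v]
    by (auto simp: set_mset_doubled K)
  moreover have "[K, N, N] @ v \<in> avoiding (doubled N)" if "v \<in> single_top k" for v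
    using that avoiding_KNN_iff[of v] by (simp add: single_top_def K)
  ultimately show "?R \<subseteq> avoiding (doubled N)"
    by (intro Un_least image_subsetI)
      (simp_all only: avoiding_KKNN_iff avoiding_NKKN_iff avoiding_NKN_iff avoiding_NN_iff)
qed

section \<open>Counting\<close>

lemma card_single_top_recursion:
  assumes "finite (avoiding (doubled k))" "finite (single_top k)"
  shows "finite (single_top K)"
    "card (single_top K) = card (avoiding (doubled k)) + card (single_top k)"
proof -
  show "finite (single_top K)" unfolding single_top_recursion using assms by simp
  show "card (single_top K) = card (avoiding (doubled k)) + card (single_top k)"
    unfolding single_top_recursion using assms N
    by (subst card_Un_disjoint) (auto simp: card_image inj_on_def)
qed

lemma card_avoiding_recursion:
  assumes "finite (avoiding (doubled K))" "finite (avoiding (doubled k))" "finite (single_top k)"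
  shows "finite (avoiding (doubled N))"
    "card (avoiding (doubled N)) =
       card (avoiding (doubled K)) + 3 * card (avoiding (doubled k)) + 2 * card (single_top k)"
proof -
  \<comment> \<open>This separates the words with prefix \<open>KNNK\<close> from those counted after \<open>KNN\<close>.\<close>
  have K_notin: "K # u \<notin> single_top k" for u
    by (auto simp: single_top_iff K)
  show "finite (avoiding (doubled N))" unfolding avoiding_recursion using assms by simp
  show "card (avoiding (doubled N)) =
       card (avoiding (doubled K)) + 3 * card (avoiding (doubled k)) + 2 * card (single_top k)"
    unfolding avoiding_recursion using assms
    by (subst card_Un_disjoint, simp, simp, (auto simp: N K_notin; fail))+
      (simp add: card_image inj_on_def)
qed

end

lemma avoiding_doubled_0: "avoiding (doubled 0) = {[]}"
  by (auto simp: avoiding_def avoids_123_132_213_def consecutive_121_Nil)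

lemma avoiding_doubled_1: "avoiding (doubled 1) = {[1, 1]}"
proof -
  have "w = [1, 1]" if m: "mset w = {#1, 1#}" for w :: "nat list"
  proof -
    have "length w = 2" using arg_cong[OF m, of size] by simp
    moreover have "replicate (length w) 1 = w"
      using arg_cong[OF m, of set_mset] by (intro replicate_length_same) simp
    ultimately show ?thesis by (simp add: numeral_2_eq_2)
  qed
  moreover have "[1, 1] \<in> avoiding (doubled 1)"
    using avoiding_Cons_largest[of "{#1#}" 1 "[1]"] avoiding_Cons_largest[of "{#}" 1 "[]"]
      avoiding_doubled_0 by simp
  moreover have "mset w = {#1, 1#}" if "w \<in> avoiding (doubled 1)" for w
    using that by (simp add: avoiding_def)
  ultimately show ?thesis by blast
qed

lemma single_top_0: "single_top 0 = {}"
  by (auto simp: single_top_def avoiding_def)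

text \<open>The formula for \<open>single_top\<close> is \<open>a1 k * a1 (k - 1)\<close>, with the difference \<open>a1 (k + 1) - a1 k\<close> for
  \<open>a1 (k - 1)\<close> so that it also covers \<open>k = 0\<close>.\<close>

lemma card_avoiding_single_top:
  "finite (avoiding (doubled k)) \<and> finite (avoiding (doubled (Suc k))) \<and> finite (single_top k) \<and>
   card (avoiding (doubled k)) = (a1 k)\<^sup>2 \<and> card (avoiding (doubled (Suc k))) = (a1 (Suc k))\<^sup>2 \<and>
   card (single_top k) + (a1 k)\<^sup>2 = a1 k * a1 (Suc k)"
proof (induction k)
  case 0
  then show ?case using avoiding_doubled_0 avoiding_doubled_1 single_top_0 by simp
next
  case (Suc k)
  then show ?case
    using card_single_top_recursion[OF refl refl, of k] card_avoiding_recursion[OF refl refl, of k]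
    by (simp add: power2_eq_square algebra_simps del: doubled.simps)
qed

theorem theorem5:
  fixes n :: nat
  shows "c n = card (Av2 n)"
  using card_avoiding_single_top[of n] by (simp add: c_def Av2_eq_avoiding)

end
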